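(* Let $\lambda=(\lambda_1,\ldots,\lambda_n)$ be a partition, set $m=\lambda_1$, and let $\alpha\in\mathbb N^n$. Consider the following procedure. For $\alpha=0^n$, the procedure returns $0^m$. Otherwise, order the support $\{i:\alpha_i\ne0\}$ as $i_1,\ldots,i_c$ so that $$\alpha_{i_1}\ge\cdots\ge\alpha_{i_c}>0,$$ breaking ties arbitrarily, and process the indices in this order. At step $t$, choose $$q_t=\max\left(\{1,\ldots,\lambda[i_t]\}\setminus\{q_1,\ldots,q_{t-1}\}\right).$$ If the set is empty, stop and declare failure. Otherwise, place the part $\alpha_{i_t}$ in position $q_t$. If all steps succeed, let $\beta\in\mathbb N^m$ be the composition given by $\beta_{q_t}=\alpha_{i_t}$ $(1\le t\le c)$ and $\beta_j=0$ at every unoccupied position $j$. Then the procedure succeeds if and only if $\alpha^\lambda$ exists. When it succeeds, $\beta=\alpha^\lambda$; in particular, the output is independent of the order chosen among equal parts of $\alpha$.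
   Context: $\mathbb N=\{0,1,2,\ldots\}$. For a weak composition $\alpha$, $\alpha^+$ is its weakly decreasing rearrangement and $K(\alpha)$ is the key tableau: the semistandard tableau (English notation) of shape $\alpha^+$ and content $\alpha$, whose column $r$ consists of $\{i:\alpha_i\ge r\}$. Partitions may be padded with trailing zeros; write $\lambda[i]=\lambda_i$. For $\alpha\in\mathbb N^n$, $B_+^\lambda(\alpha)$ is the filling of shape $\alpha^+$ such that, if column $r$ has length $c_r$, its $i$-th entry from the top is $\lambda[\,\cdot\,]$ applied to the $(c_r+1-i)$-th entry from the top of column $r$ of $K(\alpha)$. For a weakly increasing integer column written from bottom to top as $c_1\ge\cdots\ge c_k$, its strictification is the column $d_1>\cdots>d_k$ (bottom to top) with $d_1=c_1$, $d_i=\min\{d_{i-1}-1,c_i\}$. If the columnwise strictification $\operatorname{str}(B_+^\lambda(\alpha))$ has only positive entries (vacuously true if $\alpha=0$), it is a key tableau and $\alpha^\lambda\in\mathbb N^m$ is the unique weak composition with $K(\alpha^\lambda)=\operatorname{str}(B_+^\lambda(\alpha))$; otherwise $\alpha^\lambda$ does not exist. *)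

theory Defs
  imports Main
begin

text \<open>Partitions and weak compositions are lists of naturals, indexed from 1; entries beyond
  the end are 0 (padding by trailing zeros).\<close>

definition part :: "nat list \<Rightarrow> nat \<Rightarrow> nat" where
  "part xs i = (if 1 \<le> i \<and> i \<le> length xs then xs ! (i - 1) else 0)"

definition is_partition :: "nat list \<Rightarrow> bool" where
  "is_partition xs \<longleftrightarrow> sorted_wrt (\<ge>) xs"

definition decreasing_rearrangement :: "nat list \<Rightarrow> nat list" where
  "decreasing_rearrangement \<alpha> = rev (sort \<alpha>)"

text \<open>A filling of a Young diagram (English notation) is the list of its columns from left to
  right, each column being the list of its entries from top to bottom. The diagram of a partition
  has as many columns as its first part; the columns of the key tableau are determined by their
  sets of entries, since they increase strictly downwards.\<close>

definition key_tableau :: "nat list \<Rightarrow> nat list list" where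
  "key_tableau \<alpha> =
     map (\<lambda>r. sorted_list_of_set {i \<in> {1..length \<alpha>}. part \<alpha> i \<ge> r})
       [1..<Suc (part (decreasing_rearrangement \<alpha>) 1)]"

definition B_plus :: "nat list \<Rightarrow> nat list \<Rightarrow> nat list list" where
  "B_plus lam \<alpha> = map (\<lambda>col. map (part lam) (rev col)) (key_tableau \<alpha>)"

text \<open>Strictification produces possibly nonpositive integers. The next two functions read a
  column from bottom to top; the first argument of \<open>strictify_below\<close> is the entry just
  produced.\<close>

fun strictify_below :: "int \<Rightarrow> int list \<Rightarrow> int list" where
  "strictify_below d [] = []"
| "strictify_below d (c # cs) = (let d' = min (d - 1) c in d' # strictify_below d' cs)"

fun strictify_upwards :: "int list \<Rightarrow> int list" where
  "strictify_upwards [] = []"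
| "strictify_upwards (c # cs) = c # strictify_below c cs"

definition strictify_column :: "int list \<Rightarrow> int list" where
  "strictify_column col = rev (strictify_upwards (rev col))"

definition strictification :: "nat list list \<Rightarrow> int list list" where
  "strictification T = map (\<lambda>col. strictify_column (map int col)) T"

text \<open>\<open>comp_lambda lam \<alpha>\<close> stands for \<open>\<alpha>\<^sup>\<lambda>\<close>; its value matters only when
  \<open>comp_lambda_exists lam \<alpha>\<close> holds.\<close>

definition comp_lambda_exists :: "nat list \<Rightarrow> nat list \<Rightarrow> bool" where
  "comp_lambda_exists lam \<alpha> \<longleftrightarrow>
     (\<forall>col \<in> set (strictification (B_plus lam \<alpha>)). \<forall>x \<in> set col. x > 0)"

definition comp_lambda :: "nat list \<Rightarrow> nat list \<Rightarrow> nat list" where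
  "comp_lambda lam \<alpha> =
     (THE \<beta>. length \<beta> = part lam 1 \<and>
        map (map int) (key_tableau \<beta>) = strictification (B_plus lam \<alpha>))"

definition processing_order :: "nat list \<Rightarrow> nat list \<Rightarrow> bool" where
  "processing_order \<alpha> ks \<longleftrightarrow>
     distinct ks \<and> set ks = {i \<in> {1..length \<alpha>}. part \<alpha> i \<noteq> 0} \<and>
     sorted_wrt (\<lambda>i j. part \<alpha> i \<ge> part \<alpha> j) ks"

text \<open>\<open>choose_positions lam qs ks\<close> processes the indices \<open>ks\<close> when the positions \<open>qs\<close> are already
  taken, and returns all chosen positions in the order of choice; \<open>None\<close> means failure.\<close>

fun choose_positions :: "nat list \<Rightarrow> nat list \<Rightarrow> nat list \<Rightarrow> nat list option" where
  "choose_positions lam qs [] = Some qs"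
| "choose_positions lam qs (i # ks) =
     (let Q = {1..part lam i} - set qs
      in if Q = {} then None else choose_positions lam (qs @ [Max Q]) ks)"

definition place_parts :: "nat \<Rightarrow> nat list \<Rightarrow> nat list \<Rightarrow> nat list \<Rightarrow> nat list" where
  "place_parts m \<alpha> ks qs =
     map (\<lambda>j. case map_of (zip qs ks) j of None \<Rightarrow> 0 | Some i \<Rightarrow> part \<alpha> i) [1..<Suc m]"

text \<open>If \<open>\<alpha>\<close> is zero then the only processing order is empty and the result is the zero
  composition.\<close>

definition procedure :: "nat list \<Rightarrow> nat list \<Rightarrow> nat list \<Rightarrow> nat list option" where
  "procedure lam \<alpha> ks =
     map_option (place_parts (part lam 1) \<alpha> ks) (choose_positions lam [] ks)"

end

theory Submission imports "HOL-Library.Multiset" Defs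
begin

text \<open>Strictifying a column and running the procedure are the same greedy process in different
  orders. Think of each index \<open>i\<close> as a car which parks at the highest vacant integer not above its
  cap \<open>\<lambda>[i]\<close>. Strictification of column \<open>r\<close> parks the indices with \<open>\<alpha>\<^sub>i \<ge> r\<close> in increasing order
  of \<open>i\<close>, that is, with weakly decreasing caps (\<open>set_strictify_below\<close>). The procedure parks the
  same indices first, but in decreasing order of their parts.

  The set of integers occupied in the end does not depend on the order of the cars, because any two
  of them commute (\<open>park_commute\<close>): if they aim at different places they do not interfere, and
  if they aim at the same place then both orders fill it together with the next vacant place below.
  Hence the positions of \<open>\<beta>\<close> carrying parts at least \<open>r\<close> are the entries of column \<open>r\<close>
  of the strictification (\<open>strictified_column\<close>), which says that the key tableau of \<open>\<beta>\<close> is the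
  strictification. A composition of given length is determined by its key tableau
  (\<open>key_tableau_inj\<close>), so \<open>\<beta> = \<alpha>\<^sup>\<lambda>\<close> for every processing order.

  The procedure differs from parking on the integers only in that it gives up when a car would
  have to leave the positive integers. As the first column, if there is one, parks all cars, this
  happens exactly if that column has a nonpositive entry.\<close>

section \<open>Parking on the integers\<close>

text \<open>The set of vacant integers added is empty or a singleton. Describing it without a choice
  of maximum makes commutation hold for arbitrary \<open>D\<close>, even where nothing is vacant, and hence as
  an equation between functions.\<close>

definition park :: "int \<Rightarrow> int set \<Rightarrow> int set" where
  "park c D = D \<union> {x. x \<le> c \<and> x \<notin> D \<and> {x<..c} \<subseteq> D}"

lemma park_eq_insert:
  assumes "p \<le> c" "p \<notin> D" "{p<..c} \<subseteq> D"
  shows "park c D = insert p D"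
proof -
  have "x = p" if "x \<le> c" "x \<notin> D" "{x<..c} \<subseteq> D" for x
    using that assms by (metis greaterThanAtMost_iff linorder_neqE subsetD)
  then show ?thesis
    using assms unfolding park_def by blast
qed

lemma park_commute_le:
  assumes "a \<le> b"
  shows "park a (park b D) = park b (park a D)"
proof (cases "{a<..b} \<subseteq> D")
  case True
  \<comment> \<open>No place between the caps is vacant, so the two cars are interchangeable.\<close>
  have same: "park a E = park b E" if "D \<subseteq> E" for E
  proof -
    have "(x \<le> a \<and> x \<notin> E \<and> {x<..a} \<subseteq> E) \<longleftrightarrow> (x \<le> b \<and> x \<notin> E \<and> {x<..b} \<subseteq> E)" for x
    proof (cases "x \<le> a")
      case True
      then have "{x<..b} = {x<..a} \<union> {a<..b}"
        using assms by auto
      then show ?thesis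
        using \<open>{a<..b} \<subseteq> D\<close> \<open>D \<subseteq> E\<close> True assms by auto
    next
      case False
      then show ?thesis
        using \<open>{a<..b} \<subseteq> D\<close> \<open>D \<subseteq> E\<close> by force
    qed
    then show ?thesis
      unfolding park_def by simp
  qed
  have "D \<subseteq> park a D"
    unfolding park_def by blast
  then show ?thesis
    using same by (metis order_refl)
next
  case False
  \<comment> \<open>The car with cap \<open>b\<close> parks above \<open>a\<close>, the other one does not.\<close>
  then obtain y where y: "a < y" "y \<le> b" "y \<notin> D"
    by force
  define A where "A = {x. x \<le> a \<and> x \<notin> D \<and> {x<..a} \<subseteq> D}"
  define B where "B = {x. x \<le> b \<and> x \<notin> D \<and> {x<..b} \<subseteq> D}"
  have A_le: "A \<subseteq> {..a}"
    unfolding A_def by auto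
  have B_gt: "B \<subseteq> {a<..}"
  proof
    fix x assume "x \<in> B"
    then have "y \<le> x"
      using y unfolding B_def by force
    then show "x \<in> {a<..}"
      using y by auto
  qed
  have "park a (D \<union> B) = D \<union> B \<union> A"
  proof -
    have "(x \<notin> D \<union> B \<and> {x<..a} \<subseteq> D \<union> B) \<longleftrightarrow> (x \<notin> D \<and> {x<..a} \<subseteq> D)" if "x \<le> a" for x
      using that B_gt by fastforce
    then show ?thesis
      unfolding park_def A_def by blast
  qed
  moreover have "park b (D \<union> A) = D \<union> A \<union> B"
  proof -
    have "(x \<notin> D \<union> A \<and> {x<..b} \<subseteq> D \<union> A) \<longleftrightarrow> (x \<notin> D \<and> {x<..b} \<subseteq> D)" if "x \<le> b" for x
    proof (cases "x \<le> a")
      case True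
      then have "y \<in> {x<..b}" "y \<notin> D \<union> A"
        using y A_le by auto
      then show ?thesis
        by blast
    next
      case False
      then show ?thesis
        using A_le by fastforce
    qed
    then show ?thesis
      unfolding park_def B_def by blast
  qed
  moreover have "park a D = D \<union> A" "park b D = D \<union> B"
    unfolding park_def A_def B_def by auto
  ultimately show ?thesis
    by auto
qed

lemma park_commute: "park a \<circ> park b = park b \<circ> park a"
  by (rule ext) (metis comp_apply linear park_commute_le)

definition parked :: "nat list \<Rightarrow> nat list \<Rightarrow> int set" where
  "parked lam ks = fold (\<lambda>i. park (int (part lam i))) ks {}"

lemma parked_snoc: "parked lam (ks @ [i]) = park (int (part lam i)) (parked lam ks)"
  by (simp add: parked_def)

lemma parked_order_irrelevant:
  assumes "distinct ks" "distinct ks'" "set ks = set ks'"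
  shows "parked lam ks = parked lam ks'"
proof -
  have "mset ks = mset ks'"
    using assms set_eq_iff_mset_eq_distinct by blast
  then have "fold (\<lambda>i. park (int (part lam i))) ks = fold (\<lambda>i. park (int (part lam i))) ks'"
    by (intro fold_multiset_equiv park_commute)
  then show ?thesis
    by (simp add: parked_def)
qed

section \<open>Strictification parks cars with decreasing caps\<close>

lemma strictify_below_decreasing:
  "sorted_wrt (>) (strictify_below d cs) \<and> (\<forall>x \<in> set (strictify_below d cs). x < d)"
proof (induction cs arbitrary: d)
  case (Cons c cs)
  define d' where "d' = min (d - 1) c"
  have "d' < d"
    by (simp add: d'_def)
  have eq: "strictify_below d (c # cs) = d' # strictify_below d' cs"
    by (simp add: d'_def Let_def)
  have "\<forall>x \<in> set (strictify_below d' cs). x < d"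
    using Cons.IH[of d'] \<open>d' < d\<close> order.strict_trans by blast
  then show ?case
    unfolding eq using Cons.IH[of d'] \<open>d' < d\<close> by simp
qed simp

lemma strictify_upwards_eq_below: "strictify_upwards (c # cs) = strictify_below (c + 1) (c # cs)"
  by (simp add: Let_def)

text \<open>While the caps decrease, an integer not above the last cap \<open>e\<close> is vacant exactly if
  it lies below the last place \<open>d\<close> taken, so the next car parks at the minimum of \<open>d - 1\<close> and its
  cap. Before any car has parked, every \<open>d > e\<close> satisfies the hypotheses.\<close>

lemma set_strictify_below:
  assumes "sorted_wrt (\<ge>) (e # cs)" "{d..e} \<subseteq> D" "D \<subseteq> {d..}"
  shows "fold park cs D = D \<union> set (strictify_below d cs)"
  using assms
proof (induction cs arbitrary: d e D)
  case Nil
  then show ?case by simp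
next
  case (Cons c cs)
  define d' where "d' = min (d - 1) c"
  have "c \<le> e"
    using Cons.prems(1) by simp
  have "{d'<..c} \<subseteq> {d..e}"
    using \<open>c \<le> e\<close> by (auto simp: d'_def min_def split: if_splits)
  then have "{d'<..c} \<subseteq> D"
    using Cons.prems(2) by blast
  moreover have "d' \<le> c" "d' \<notin> D"
    using Cons.prems(3) by (auto simp: d'_def)
  ultimately have park: "park c D = insert d' D"
    by (intro park_eq_insert)
  have "{d'..c} \<subseteq> insert d' D"
    using \<open>{d'<..c} \<subseteq> D\<close> by force
  moreover have "insert d' D \<subseteq> {d'..}"
    using Cons.prems(3) by (auto simp: d'_def)
  ultimately have "fold park cs (insert d' D) = insert d' D \<union> set (strictify_below d' cs)"
    using Cons.prems(1) by (intro Cons.IH) auto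
  then show ?case
    by (simp add: park d'_def Let_def)
qed

lemma strictly_increasing_eq_sorted_list_of_set:
  assumes "sorted_wrt (<) xs"
  shows "xs = sorted_list_of_set (set xs)"
  using assms by (metis sorted_list_of_set.idem_if_sorted_distinct strict_sorted_iff)

lemma strictify_column_eq:
  assumes "sorted_wrt (\<ge>) cs"
  shows "strictify_column (rev cs) = sorted_list_of_set (fold park cs {})"
proof (cases cs)
  case Nil
  then show ?thesis
    by (simp add: strictify_column_def)
next
  case (Cons c cs')
  then have col: "strictify_column (rev cs) = rev (strictify_below (c + 1) cs)"
    by (simp only: strictify_column_def rev_rev_ident strictify_upwards_eq_below)
  have "fold park cs {} = {} \<union> set (strictify_below (c + 1) cs)"
    using assms Cons by (intro set_strictify_below[where e = c]) auto
  then have "set (strictify_column (rev cs)) = fold park cs {}"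
    by (simp add: col)
  moreover have "sorted_wrt (<) (strictify_column (rev cs))"
    using strictify_below_decreasing[of "c + 1" cs] by (simp add: col sorted_wrt_rev)
  ultimately show ?thesis
    using strictly_increasing_eq_sorted_list_of_set by metis
qed

section \<open>Key tableaux and level sets\<close>

definition level :: "nat list \<Rightarrow> nat \<Rightarrow> nat set" where
  "level xs r = {i \<in> {1..length xs}. r \<le> part xs i}"

definition num_columns :: "nat list \<Rightarrow> nat" where
  "num_columns xs = part (decreasing_rearrangement xs) 1"

lemma finite_level [simp]: "finite (level xs r)"
  by (simp add: level_def)

lemma key_tableau_eq:
  "key_tableau xs = map (\<lambda>r. sorted_list_of_set (level xs r)) [1..<Suc (num_columns xs)]"
  by (simp add: key_tableau_def level_def num_columns_def)

lemma part_mem: "1 \<le> i \<Longrightarrow> i \<le> length xs \<Longrightarrow> part xs i \<in> set xs"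
  unfolding part_def using nth_mem[of "i - 1" xs] by simp

lemma mem_imp_part:
  assumes "x \<in> set xs"
  shows "\<exists>i. 1 \<le> i \<and> i \<le> length xs \<and> part xs i = x"
proof -
  obtain j where "j < length xs" "xs ! j = x"
    using assms by (auto simp: in_set_conv_nth)
  then show ?thesis
    by (intro exI[of _ "Suc j"]) (simp add: part_def)
qed

lemma num_columns_is_max:
  assumes "xs \<noteq> []"
  shows "num_columns xs \<in> set xs" and "x \<in> set xs \<Longrightarrow> x \<le> num_columns xs"
proof -
  have nc: "num_columns xs = last (sort xs)"
  proof -
    have "sort xs \<noteq> []" "1 \<le> length (sort xs)"
      using assms by (cases xs; simp)+
    then show ?thesis
      using assms rev_nth[of 0 "sort xs"]
      by (simp add: num_columns_def part_def decreasing_rearrangement_def last_conv_nth)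
  qed
  then show "num_columns xs \<in> set xs"
    using assms by (metis last_in_set set_empty set_sort)
  show "x \<le> num_columns xs" if "x \<in> set xs"
  proof -
    have "x \<in> set (sort xs)"
      using that by simp
    then obtain i where i: "i < length (sort xs)" "sort xs ! i = x"
      unfolding in_set_conv_nth by blast
    then have "sort xs ! i \<le> sort xs ! (length (sort xs) - 1)"
      by (intro sorted_nth_mono) auto
    then show ?thesis
      using i \<open>x \<in> set (sort xs)\<close> by (cases "sort xs = []") (simp_all add: nc last_conv_nth)
  qed
qed

lemma level_nonempty_iff:
  assumes "1 \<le> r"
  shows "level xs r \<noteq> {} \<longleftrightarrow> r \<le> num_columns xs"
proof (cases "xs = []")
  case True
  then show ?thesis
    using assms by (simp add: level_def num_columns_def part_def decreasing_rearrangement_def)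
next
  case False
  have "r \<le> num_columns xs" if "i \<in> level xs r" for i
    using that num_columns_is_max(2)[OF False part_mem[of i xs]] by (auto simp: level_def)
  moreover obtain i where "1 \<le> i" "i \<le> length xs" "part xs i = num_columns xs"
    using mem_imp_part[OF num_columns_is_max(1)[OF False]] by blast
  ultimately show ?thesis
    by (auto simp: level_def)
qed

lemma nat_eq_if_same_lower_bounds:
  fixes a b :: nat
  assumes "\<And>r. 1 \<le> r \<Longrightarrow> r \<le> a \<longleftrightarrow> r \<le> b"
  shows "a = b"
  using assms[of a] assms[of b] by (cases "a = 0"; cases "b = 0") auto

lemma num_columns_cong:
  assumes "\<And>r. 1 \<le> r \<Longrightarrow> level xs r = {} \<longleftrightarrow> level ys r = {}"
  shows "num_columns xs = num_columns ys"
proof -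
  have "r \<le> num_columns xs \<longleftrightarrow> r \<le> num_columns ys" if "1 \<le> r" for r
    using assms[OF that] level_nonempty_iff[OF that] by blast
  then show ?thesis
    by (rule nat_eq_if_same_lower_bounds)
qed

text \<open>A part is the largest \<open>r\<close> for which its index lies in column \<open>r\<close>.\<close>

lemma key_tableau_inj:
  assumes "length xs = length ys" "key_tableau xs = key_tableau ys"
  shows "xs = ys"
proof -
  have nc: "num_columns xs = num_columns ys"
    using arg_cong[OF assms(2), of length] by (simp add: key_tableau_eq del: upt_Suc)
  have level: "level xs r = level ys r" if "1 \<le> r" for r
  proof (cases "r \<le> num_columns xs")
    case True
    then have "r \<in> set [1..<Suc (num_columns xs)]"
      using that by auto
    then have "sorted_list_of_set (level xs r) = sorted_list_of_set (level ys r)"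
      using assms(2) unfolding key_tableau_eq nc map_eq_conv by blast
    then show ?thesis
      by (metis finite_level sorted_list_of_set.set_sorted_key_list_of_set)
  next
    case False
    then show ?thesis
      using level_nonempty_iff[OF that] nc by metis
  qed
  have part: "part xs i = part ys i" if "1 \<le> i" "i \<le> length xs" for i
  proof -
    have "r \<le> part xs i \<longleftrightarrow> r \<le> part ys i" if "1 \<le> r" for r
      using level[OF that] \<open>1 \<le> i\<close> \<open>i \<le> length xs\<close> assms(1) by (auto simp: level_def)
    then show ?thesis
      by (rule nat_eq_if_same_lower_bounds)
  qed
  show ?thesis
  proof (rule nth_equalityI)
    show "xs ! j = ys ! j" if "j < length xs" for j
      using part[of "Suc j"] that assms(1) by (simp add: part_def)
  qed (rule assms(1))
qed

lemma part_partition_antimono: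
  assumes "is_partition lam" "1 \<le> i" "i \<le> j"
  shows "part lam j \<le> part lam i"
proof (cases "i = j \<or> length lam < j")
  case False
  then have "i - 1 < j - 1" "j - 1 < length lam"
    using assms(2,3) by auto
  then have "lam ! (j - 1) \<le> lam ! (i - 1)"
    using assms(1) sorted_wrt_nth_less unfolding is_partition_def by metis
  then show ?thesis
    using assms(2,3) False by (simp add: part_def)
qed (auto simp: part_def)

text \<open>The columns of the key tableau list their indices in increasing order, so their caps
  decrease.\<close>

lemma strictification_B_plus_eq:
  assumes "is_partition lam"
  shows "strictification (B_plus lam \<alpha>) =
    map (\<lambda>r. sorted_list_of_set (parked lam (sorted_list_of_set (level \<alpha> r))))
      [1..<Suc (num_columns \<alpha>)]"
proof -
  have "strictify_column (map int (map (part lam) (rev (sorted_list_of_set (level \<alpha> r))))) =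
      sorted_list_of_set (parked lam (sorted_list_of_set (level \<alpha> r)))" for r
  proof -
    define idxs where "idxs = sorted_list_of_set (level \<alpha> r)"
    have "sorted_wrt (<) idxs" "set idxs \<subseteq> {1..}"
      by (auto simp: idxs_def level_def)
    then have "sorted_wrt (\<lambda>i j. part lam j \<le> part lam i) idxs"
      using sorted_wrt_mono_rel[of idxs "(<)" "\<lambda>i j. part lam j \<le> part lam i"]
        part_partition_antimono[OF assms]
      by (meson atLeast_iff order.strict_implies_order subsetD)
    then have "sorted_wrt (\<ge>) (map (\<lambda>i. int (part lam i)) idxs)"
      by (simp add: sorted_wrt_map)
    from strictify_column_eq[OF this] show ?thesis
      by (simp add: parked_def fold_map comp_def rev_map idxs_def)
  qed
  then show ?thesis
    by (simp add: strictification_def B_plus_def key_tableau_eq)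
qed

section \<open>The procedure parks cars as long as they stay positive\<close>

lemma choose_positions_snoc:
  "choose_positions lam qs (ks @ [i]) =
    (case choose_positions lam qs ks of
      None \<Rightarrow> None
    | Some ps \<Rightarrow> (let Q = {1..part lam i} - set ps in if Q = {} then None else Some (ps @ [Max Q])))"
proof (induction ks arbitrary: qs)
  case Nil
  show ?case
    unfolding append_Nil choose_positions.simps option.case Let_def by (rule refl)
next
  case (Cons k ks)
  show ?case
    unfolding append_Cons choose_positions.simps(2) Let_def
    by (cases "{1..part lam k} - set qs = {}")
      (simp_all only: simp_thms if_True if_False option.case Cons.IH Let_def)
qed

text \<open>As long as a positive place not above the cap is vacant, the highest vacant integer is positive,
  so the choice made by the procedure is the one made on the integers.\<close>

lemma park_Max:
  assumes "{1..c} - A \<noteq> {}"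
  shows "park (int c) (int ` A) = insert (int (Max ({1..c} - A))) (int ` A)"
proof (rule park_eq_insert)
  define q where "q = Max ({1..c} - A)"
  have q: "q \<in> {1..c} - A"
    unfolding q_def by (rule Max_in) (use assms in auto)
  then show "int (Max ({1..c} - A)) \<le> int c" "int (Max ({1..c} - A)) \<notin> int ` A"
    by (auto simp: q_def)
  have "x \<in> A" if "q < x" "x \<le> c" for x
  proof (rule ccontr)
    assume "x \<notin> A"
    then have "x \<le> q"
      unfolding q_def using that by (intro Max_ge) auto
    then show False
      using that by simp
  qed
  then show "{int (Max ({1..c} - A))<..int c} \<subseteq> int ` A"
    unfolding q_def[symmetric]
  proof (intro subsetI)
    fix x assume "x \<in> {int q<..int c}"
    then have "q < nat x" "nat x \<le> c" "x = int (nat x)"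
      by auto
    then show "x \<in> int ` A"
      using \<open>\<And>x. q < x \<Longrightarrow> x \<le> c \<Longrightarrow> x \<in> A\<close> by blast
  qed
qed

lemma zero_mem_park:
  assumes "{1..c} - A = {}" "0 \<notin> A"
  shows "0 \<in> park (int c) (int ` A)"
proof -
  have "{0<..int c} \<subseteq> int ` A"
  proof
    fix x assume "x \<in> {0<..int c}"
    then have "nat x \<in> {1..c}" "x = int (nat x)"
      by auto
    then show "x \<in> int ` A"
      using assms(1) by blast
  qed
  then show ?thesis
    using assms(2) by (auto simp: park_def)
qed

text \<open>The claim about initial segments is what relates a single run of the procedure to all columns
  at once: each column collects the indices handled up to some step.\<close>

lemma choose_positions_parks:
  assumes "choose_positions lam [] ks = Some ps"
  shows "length ps = length ks" and "distinct ps"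
    and "list_all2 (\<lambda>p i. 1 \<le> p \<and> p \<le> part lam i) ps ks"
    and "int ` set (take t ps) = parked lam (take t ks)"
proof -
  have "length ps = length ks \<and> distinct ps \<and>
      list_all2 (\<lambda>p i. 1 \<le> p \<and> p \<le> part lam i) ps ks \<and>
      (\<forall>t. int ` set (take t ps) = parked lam (take t ks))"
    using assms
  proof (induction ks arbitrary: ps rule: rev_induct)
    case Nil
    then show ?case by (simp add: parked_def)
  next
    case (snoc i ks)
    then obtain qs where qs: "choose_positions lam [] ks = Some qs"
      by (auto simp: choose_positions_snoc split: option.splits)
    define Q where "Q = {1..part lam i} - set qs"
    have Q: "Q \<noteq> {}" and ps: "ps = qs @ [Max Q]"
      using snoc.prems qs by (auto simp: choose_positions_snoc Q_def Let_def split: if_splits)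
    have MaxQ: "Max Q \<in> Q"
      by (rule Max_in) (use Q in \<open>auto simp: Q_def\<close>)
    note IH = snoc.IH[OF qs]
    have all: "int ` set qs = parked lam ks"
      using IH by (metis order.refl take_all)
    have "int ` set ps = parked lam (ks @ [i])"
      using park_Max[of "part lam i" "set qs"] Q by (simp add: ps parked_snoc Q_def flip: all)
    then have "int ` set (take t ps) = parked lam (take t (ks @ [i]))" for t
      using IH by (cases "t \<le> length ks") (auto simp: ps)
    then show ?case
      using IH MaxQ by (auto simp: ps Q_def list_all2_appendI)
  qed
  then show "length ps = length ks" "distinct ps"
    "list_all2 (\<lambda>p i. 1 \<le> p \<and> p \<le> part lam i) ps ks"
    "int ` set (take t ps) = parked lam (take t ks)"
    by auto
qed

lemma choose_positions_succeeds:
  assumes "parked lam ks \<subseteq> {1..}"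
  shows "choose_positions lam [] ks \<noteq> None"
  using assms
proof (induction ks rule: rev_induct)
  case Nil
  then show ?case by simp
next
  case (snoc i ks)
  have "parked lam ks \<subseteq> {1..}"
    using snoc.prems by (auto simp: parked_snoc park_def)
  then obtain qs where qs: "choose_positions lam [] ks = Some qs"
    using snoc.IH by blast
  have all: "int ` set qs = parked lam ks"
    using choose_positions_parks(4)[OF qs, of "length ks"] choose_positions_parks(1)[OF qs] by simp
  have "0 \<notin> set qs"
    using all \<open>parked lam ks \<subseteq> {1..}\<close> by force
  \<comment> \<open>If no positive place were left, the next car would park at 0.\<close>
  have "{1..part lam i} - set qs \<noteq> {}"
  proof
    assume "{1..part lam i} - set qs = {}"
    from zero_mem_park[OF this \<open>0 \<notin> set qs\<close>] show False
      using snoc.prems by (auto simp: parked_snoc all)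
  qed
  then show ?case
    by (simp add: choose_positions_snoc qs Let_def)
qed

section \<open>The composition produced by the procedure\<close>

lemma level_one_eq: "level \<alpha> 1 = {i \<in> {1..length \<alpha>}. part \<alpha> i \<noteq> 0}"
  by (auto simp: level_def)

lemma parked_processing_order:
  assumes "processing_order \<alpha> ks"
  shows "parked lam ks = parked lam (sorted_list_of_set (level \<alpha> 1))"
  using assms unfolding processing_order_def
  by (intro parked_order_irrelevant) (simp_all add: level_one_eq del: One_nat_def)

text \<open>As the parts decrease along the processing order, the indices with parts at least \<open>r\<close>
  form an initial segment.\<close>

lemma processing_order_prefix:
  assumes "processing_order \<alpha> ks"
  obtains k where "k \<le> length ks" "\<And>t. t < length ks \<Longrightarrow> t < k \<longleftrightarrow> r \<le> part \<alpha> (ks ! t)"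
proof
  define k where "k = length (takeWhile (\<lambda>i. r \<le> part \<alpha> i) ks)"
  show "length (takeWhile (\<lambda>i. r \<le> part \<alpha> i) ks) \<le> length ks"
    by (rule length_takeWhile_le)
  fix t assume t: "t < length ks"
  have "r \<le> part \<alpha> (ks ! t)" if "t < k"
    using that unfolding k_def by (metis nth_mem set_takeWhileD takeWhile_nth)
  moreover have "\<not> r \<le> part \<alpha> (ks ! t)" if "k \<le> t"
  proof -
    have "\<not> r \<le> part \<alpha> (ks ! k)"
      using that t nth_length_takeWhile[of "\<lambda>i. r \<le> part \<alpha> i" ks] by (simp add: k_def)
    moreover have "part \<alpha> (ks ! t) \<le> part \<alpha> (ks ! k)"
      using assms that t sorted_wrt_nth_less[of _ ks k t]
      by (cases "k = t") (auto simp: processing_order_def)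
    ultimately show ?thesis
      by simp
  qed
  ultimately show "t < length (takeWhile (\<lambda>i. r \<le> part \<alpha> i) ks) \<longleftrightarrow> r \<le> part \<alpha> (ks ! t)"
    unfolding k_def[symmetric] by (meson not_le)
qed

lemma length_place_parts [simp]: "length (place_parts m \<alpha> ks ps) = m"
  by (simp add: place_parts_def)

lemma level_place_parts:
  assumes "1 \<le> r" "length ps = length ks" "distinct ps" "set ps \<subseteq> {1..m}"
  shows "level (place_parts m \<alpha> ks ps) r = {ps ! t |t. t < length ks \<and> r \<le> part \<alpha> (ks ! t)}"
proof -
  have map_of: "map_of (zip ps ks) j = Some i \<longleftrightarrow> (\<exists>t < length ks. ps ! t = j \<and> ks ! t = i)" for j i
    using assms(2,3) by (auto simp: in_set_zip)
  have part: "part (place_parts m \<alpha> ks ps) j =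
      (case map_of (zip ps ks) j of None \<Rightarrow> 0 | Some i \<Rightarrow> part \<alpha> i)" if "j \<in> {1..m}" for j
  proof -
    have "[1..<Suc m] ! (j - 1) = j" "j - 1 < length [1..<Suc m]"
      using that by (auto simp: nth_upt simp del: upt_Suc)
    then show ?thesis
      using that by (simp add: place_parts_def part_def[of _ j] del: upt_Suc One_nat_def)
  qed
  have "r \<le> part (place_parts m \<alpha> ks ps) j \<longleftrightarrow>
      (\<exists>t < length ks. ps ! t = j \<and> r \<le> part \<alpha> (ks ! t))" if "j \<in> {1..m}" for j
  proof (cases "map_of (zip ps ks) j")
    case None
    then have "\<not> (\<exists>t < length ks. ps ! t = j)"
      using map_of by (metis option.distinct(1))
    then show ?thesis
      using None part[OF that] assms(1) by auto
  next
    case (Some i)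
    then have "(\<exists>t < length ks. ps ! t = j \<and> ks ! t = i)"
      using map_of by blast
    moreover have "ks ! t = i" if "t < length ks" "ps ! t = j" for t
      using that map_of[of j "ks ! t"] Some by auto
    moreover have "part (place_parts m \<alpha> ks ps) j = part \<alpha> i"
      using Some part[OF that] by simp
    ultimately show ?thesis
      by metis
  qed
  moreover have "ps ! t \<in> {1..m}" if "t < length ks" for t
    using that assms(2,4) nth_mem[of t ps] by (auto simp del: nth_mem)
  ultimately show ?thesis
    by (fastforce simp: level_def)
qed

lemma level_prefixes:
  assumes "is_partition lam" "processing_order \<alpha> ks" "choose_positions lam [] ks = Some ps" "1 \<le> r"
  obtains k where "level \<alpha> r = set (take k ks)"
    "level (place_parts (part lam 1) \<alpha> ks ps) r = set (take k ps)"
proof -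
  note ps = choose_positions_parks[OF assms(3)]
  obtain k where k: "k \<le> length ks" "\<And>t. t < length ks \<Longrightarrow> t < k \<longleftrightarrow> r \<le> part \<alpha> (ks ! t)"
    using processing_order_prefix[OF assms(2)] by blast
  have prefix: "{t. t < length ks \<and> r \<le> part \<alpha> (ks ! t)} = {..<k}"
  proof -
    have "(t < length ks \<and> r \<le> part \<alpha> (ks ! t)) \<longleftrightarrow> t < k" for t
      using k(1) k(2)[of t] by (meson less_le_trans)
    then show ?thesis
      by blast
  qed
  have ks: "set ks = level \<alpha> 1"
    using assms(2) unfolding processing_order_def level_one_eq by auto
  have pos: "set ps \<subseteq> {1..part lam 1}"
  proof
    fix p assume "p \<in> set ps"
    then obtain t where "t < length ps" "ps ! t = p"
      unfolding in_set_conv_nth by blast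
    then have "ks ! t \<in> set ks" "1 \<le> p" "p \<le> part lam (ks ! t)"
      using list_all2_nthD[OF ps(3), of t] ps(1) by auto
    moreover have "part lam (ks ! t) \<le> part lam 1"
      using \<open>ks ! t \<in> set ks\<close> part_partition_antimono[OF assms(1)] by (auto simp: ks level_def)
    ultimately show "p \<in> {1..part lam 1}"
      by simp
  qed
  have "level \<alpha> r = {i \<in> set ks. r \<le> part \<alpha> i}"
    using assms(4) by (auto simp: ks level_def)
  also have "\<dots> = (!) ks ` {t. t < length ks \<and> r \<le> part \<alpha> (ks ! t)}"
    by (auto simp: in_set_conv_nth)
  also have "\<dots> = set (take k ks)"
    unfolding prefix using k(1) by (simp add: nth_image lessThan_atLeast0)
  finally have \<alpha>: "level \<alpha> r = set (take k ks)" .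
  have "level (place_parts (part lam 1) \<alpha> ks ps) r =
      (!) ps ` {t. t < length ks \<and> r \<le> part \<alpha> (ks ! t)}"
    unfolding level_place_parts[OF assms(4) ps(1,2) pos] by blast
  also have "\<dots> = set (take k ps)"
    unfolding prefix using k(1) ps(1) by (simp add: nth_image lessThan_atLeast0)
  finally show thesis
    using that \<alpha> by blast
qed

lemma strictified_column:
  assumes "is_partition lam" "processing_order \<alpha> ks" "choose_positions lam [] ks = Some ps" "1 \<le> r"
  shows "int ` level (place_parts (part lam 1) \<alpha> ks ps) r =
    parked lam (sorted_list_of_set (level \<alpha> r))"
proof -
  obtain k where k: "level \<alpha> r = set (take k ks)"
      "level (place_parts (part lam 1) \<alpha> ks ps) r = set (take k ps)"
    using level_prefixes[OF assms] .
  have "distinct (take k ks)"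
    using assms(2) by (simp add: processing_order_def)
  then have "parked lam (take k ks) = parked lam (sorted_list_of_set (level \<alpha> r))"
    by (intro parked_order_irrelevant) (simp_all add: k)
  then show ?thesis
    unfolding k(2) choose_positions_parks(4)[OF assms(3)] .
qed

lemma key_tableau_place_parts:
  assumes "is_partition lam" "processing_order \<alpha> ks" "choose_positions lam [] ks = Some ps"
  shows "map (map int) (key_tableau (place_parts (part lam 1) \<alpha> ks ps)) =
    strictification (B_plus lam \<alpha>)"
proof -
  define \<beta> where "\<beta> = place_parts (part lam 1) \<alpha> ks ps"
  have "level \<beta> r = {} \<longleftrightarrow> level \<alpha> r = {}" if "1 \<le> r" for r
    using level_prefixes[OF assms that] choose_positions_parks(1)[OF assms(3)]
    unfolding \<beta>_def by (metis length_0_conv set_empty take_eq_Nil)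
  then have nc: "num_columns \<beta> = num_columns \<alpha>"
    by (rule num_columns_cong)
  have "map int (sorted_list_of_set (level \<beta> r)) =
      sorted_list_of_set (parked lam (sorted_list_of_set (level \<alpha> r)))" if "1 \<le> r" for r
  proof -
    have "sorted_wrt (<) (map int (sorted_list_of_set (level \<beta> r)))"
      by (simp add: sorted_wrt_map)
    from strictly_increasing_eq_sorted_list_of_set[OF this] show ?thesis
      by (simp add: strictified_column[OF assms that, folded \<beta>_def])
  qed
  then show ?thesis
    unfolding strictification_B_plus_eq[OF assms(1)] \<beta>_def[symmetric]
    by (simp add: key_tableau_eq nc del: upt_Suc)
qed

lemma comp_lambda_eqI:
  assumes "length \<beta> = part lam 1"
    "map (map int) (key_tableau \<beta>) = strictification (B_plus lam \<alpha>)"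
  shows "comp_lambda lam \<alpha> = \<beta>"
  unfolding comp_lambda_def
proof (rule the_equality)
  show "length \<beta> = part lam 1 \<and>
      map (map int) (key_tableau \<beta>) = strictification (B_plus lam \<alpha>)"
    using assms by blast
next
  fix \<gamma> assume \<gamma>: "length \<gamma> = part lam 1 \<and>
      map (map int) (key_tableau \<gamma>) = strictification (B_plus lam \<alpha>)"
  then have "map (map int) (key_tableau \<gamma>) = map (map int) (key_tableau \<beta>)"
    using assms(2) by simp
  then have "key_tableau \<gamma> = key_tableau \<beta>"
    by (simp add: inj_map_eq_map inj_mapI)
  then show "\<gamma> = \<beta>"
    using \<gamma> assms(1) by (simp add: key_tableau_inj)
qed

lemma comp_lambda_exists_if_key:
  assumes "map (map int) (key_tableau \<beta>) = strictification (B_plus lam \<alpha>)"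
  shows "comp_lambda_exists lam \<alpha>"
  unfolding comp_lambda_exists_def assms[symmetric]
  by (auto simp: key_tableau_eq level_def simp del: upt_Suc)

text \<open>An infinite set would be listed as the empty column, whose entries are vacuously positive.\<close>

lemma finite_parked: "finite (parked lam ks)"
proof (induction ks rule: rev_induct)
  case Nil
  then show ?case by (simp add: parked_def)
next
  case (snoc i ks)
  have "park c D = D \<or> (\<exists>p. park c D = insert p D)" for c D
    by (cases "\<exists>p. p \<le> c \<and> p \<notin> D \<and> {p<..c} \<subseteq> D")
      (auto simp: park_eq_insert, auto simp: park_def)
  then show ?case
    using snoc by (metis finite_insert parked_snoc)
qed

lemma choose_positions_succeeds_if_exists:
  assumes "is_partition lam" "processing_order \<alpha> ks" "comp_lambda_exists lam \<alpha>"
  shows "choose_positions lam [] ks \<noteq> None"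
proof (cases "ks = []")
  case False
  have "set ks = level \<alpha> 1"
    using assms(2) unfolding processing_order_def level_one_eq by auto
  then have "1 \<le> num_columns \<alpha>"
    using False level_nonempty_iff[of 1 \<alpha>] by auto
  then have "1 \<in> set [1..<Suc (num_columns \<alpha>)]"
    by auto
  then have "sorted_list_of_set (parked lam (sorted_list_of_set (level \<alpha> 1)))
      \<in> set (strictification (B_plus lam \<alpha>))"
    unfolding strictification_B_plus_eq[OF assms(1)] set_map by (rule imageI)
  then have "\<forall>x \<in> set (sorted_list_of_set (parked lam ks)). x > 0"
    using assms(3) unfolding comp_lambda_exists_def parked_processing_order[OF assms(2)] by blast
  then have "parked lam ks \<subseteq> {1..}"
    by (auto simp: finite_parked)
  then show ?thesis
    by (rule choose_positions_succeeds)
qed simp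

theorem proposition45:
  fixes lam \<alpha> :: "nat list" and n m :: nat
  assumes "length lam = n" and "is_partition lam" and "m = part lam 1"
    and "length \<alpha> = n"
  shows "(\<forall>ks. processing_order \<alpha> ks \<longrightarrow>
            (procedure lam \<alpha> ks \<noteq> None \<longleftrightarrow> comp_lambda_exists lam \<alpha>) \<and>
            (\<forall>\<beta>. procedure lam \<alpha> ks = Some \<beta> \<longrightarrow> length \<beta> = m \<and> \<beta> = comp_lambda lam \<alpha>)) \<and>
         (\<forall>ks ks'. processing_order \<alpha> ks \<and> processing_order \<alpha> ks' \<longrightarrow>
            procedure lam \<alpha> ks = procedure lam \<alpha> ks')"
proof -
  have returned: "length \<beta> = m \<and> \<beta> = comp_lambda lam \<alpha> \<and> comp_lambda_exists lam \<alpha>"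
    if ks: "processing_order \<alpha> ks" and \<beta>: "procedure lam \<alpha> ks = Some \<beta>" for ks \<beta>
  proof -
    obtain ps where ps: "choose_positions lam [] ks = Some ps"
      and \<beta>: "\<beta> = place_parts (part lam 1) \<alpha> ks ps"
      using \<beta> by (auto simp: procedure_def)
    have "map (map int) (key_tableau \<beta>) = strictification (B_plus lam \<alpha>)"
      unfolding \<beta> by (rule key_tableau_place_parts[OF assms(2) ks ps])
    then show ?thesis
      using comp_lambda_eqI[of \<beta> lam \<alpha>] comp_lambda_exists_if_key assms(3)
      by (simp add: \<beta>)
  qed
  have succeeds: "procedure lam \<alpha> ks \<noteq> None \<longleftrightarrow> comp_lambda_exists lam \<alpha>"
    if "processing_order \<alpha> ks" for ks
    using returned[OF that] choose_positions_succeeds_if_exists[OF assms(2) that]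
    by (auto simp: procedure_def)
  have "procedure lam \<alpha> ks = procedure lam \<alpha> ks'"
    if "processing_order \<alpha> ks" "processing_order \<alpha> ks'" for ks ks'
    using that[THEN succeeds] that[THEN returned]
    by (cases "procedure lam \<alpha> ks"; cases "procedure lam \<alpha> ks'") auto
  then show ?thesis
    using returned succeeds by blast
qed

end
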